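(* Let $V$ and $E$ be finite sets and let $F\colon\{0,1\}^V \to \mathbb{R}^E$ be a submodular transformation with $F(\emptyset) = F(V) = \mathbf{0}$ and $F(S) \in [0,1]^E$ for every $S \subseteq V$ (and with every degree $\mathbf{d}_F(v)$, $v\in V$, positive). Then \[ \frac{\lambda_F}{2} \leq \phi_F \leq 2\sqrt{\lambda_F}. \]
   Context: Subsets of $V$ are identified with their indicator vectors. For $F\colon\{0,1\}^V\to\mathbb{R}^E$ and $e\in E$, $F_e(S) := F(S)(e)$; $F$ is a submodular transformation if every $F_e$ is submodular. For a set function $G\colon\{0,1\}^V\to\mathbb{R}$, its base polytope is $B(G)=\{\mathbf{x}\in\mathbb{R}^V : \sum_{v\in S}\mathbf{x}(v)\le G(S)\ \forall S\subseteq V,\ \sum_{v\in V}\mathbf{x}(v)=G(V)\}$, its Lovász extension is $g(\mathbf{x})=\max_{\mathbf{w}\in B(G)}\langle \mathbf{w},\mathbf{x}\rangle$, and $\partial g(\mathbf{x})=\operatorname{argmax}_{\mathbf{w}\in B(G)}\langle\mathbf{w},\mathbf{x}\rangle$. Let $f_e$ denote the Lovász extension of $F_e$. An element $v$ is relevant to $F_e$ if $F_e(S)\ne F_e(S\cup\{v\})$ for some $S\subseteq V\setminus\{v\}$; $\mathrm{supp}(F_e)$ is the set of relevant elements. The degree is $\mathbf{d}_F(v)=\#\{e\in E: v\in\mathrm{supp}(F_e)\}$ (assumed positive for all $v$), $D_F$ is the diagonal matrix with entries $\mathbf{d}_F(v)$, $\mathrm{vol}_F(S)=\sum_{v\in S}\mathbf{d}_F(v)$,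 $\mathrm{cut}_F(S)=\sum_{e\in E}F_e(S)$, $\phi_F(S)=\frac{\min\{\mathrm{cut}_F(S),\mathrm{cut}_F(V\setminus S)\}}{\min\{\mathrm{vol}_F(S),\mathrm{vol}_F(V\setminus S)\}}$ and $\phi_F=\min_{\emptyset\ne S\subsetneq V}\phi_F(S)$. The Laplacian is the set-valued map $L_F(\mathbf{x})=\{\sum_{e\in E}\mathbf{w}_e\langle\mathbf{w}_e,\mathbf{x}\rangle : \mathbf{w}_e\in\partial f_e(\mathbf{x})\ (e\in E)\}$ and the normalized Laplacian is $\mathcal{L}_F(\mathbf{x})=\{D_F^{-1/2}\mathbf{z} : \mathbf{z}\in L_F(D_F^{-1/2}\mathbf{x})\}$. A real $\lambda$ is an eigenvalue of $\mathcal{L}_F$ if $\lambda\mathbf{v}\in\mathcal{L}_F(\mathbf{v})$ for some nonzero $\mathbf{v}$; it is non-trivial if such $\mathbf{v}$ can be chosen orthogonal to $D_F^{1/2}\mathbf{1}$. $\lambda_F$ denotes the smallest non-trivial eigenvalue of $\mathcal{L}_F$. *)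

theory Defs
  imports "HOL-Analysis.Analysis"
begin

text \<open>
  The finite ground sets $V$ and $E$ are the universes of the finite types \<open>'v\<close> and \<open>'e\<close>;
  a function on $\{0,1\}^V$ is a function on \<open>'v set\<close>, subsets being identified with
  their indicator vectors.
\<close>

definition submodular :: "('v set \<Rightarrow> real) \<Rightarrow> bool" where
  "submodular G \<longleftrightarrow> (\<forall>S T. G (S \<union> T) + G (S \<inter> T) \<le> G S + G T)"

definition component :: "('v set \<Rightarrow> real ^ 'e) \<Rightarrow> 'e \<Rightarrow> 'v set \<Rightarrow> real" where
  "component F e S = F S $ e"

definition submodular_transformation :: "('v set \<Rightarrow> real ^ 'e) \<Rightarrow> bool" where
  "submodular_transformation F \<longleftrightarrow> (\<forall>e. submodular (component F e))"

definition base_polytope :: "('v::finite set \<Rightarrow> real) \<Rightarrow> (real ^ 'v) set" where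
  "base_polytope G =
     {x. (\<forall>S. (\<Sum>v\<in>S. x $ v) \<le> G S) \<and> (\<Sum>v\<in>UNIV. x $ v) = G UNIV}"

definition lovasz_extension :: "('v::finite set \<Rightarrow> real) \<Rightarrow> real ^ 'v \<Rightarrow> real" where
  "lovasz_extension G x = (SUP w\<in>base_polytope G. w \<bullet> x)"

definition lovasz_subdifferential ::
    "('v::finite set \<Rightarrow> real) \<Rightarrow> real ^ 'v \<Rightarrow> (real ^ 'v) set" where
  "lovasz_subdifferential G x =
     {w. is_arg_max (\<lambda>w. w \<bullet> x) (\<lambda>w. w \<in> base_polytope G) w}"

lemma lovasz_subdifferential_attains:
  assumes "w \<in> lovasz_subdifferential G x"
  shows "w \<bullet> x = lovasz_extension G x"
proof -
  have "w \<in> base_polytope G" "\<And>u. u \<in> base_polytope G \<Longrightarrow> u \<bullet> x \<le> w \<bullet> x"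
    using assms by (auto simp: lovasz_subdifferential_def is_arg_max_def not_less)
  then show ?thesis
    unfolding lovasz_extension_def by (intro cSup_eq_maximum [symmetric]) auto
qed

definition relevant :: "('v set \<Rightarrow> real) \<Rightarrow> 'v \<Rightarrow> bool" where
  "relevant G v \<longleftrightarrow> (\<exists>S \<subseteq> UNIV - {v}. G S \<noteq> G (S \<union> {v}))"

definition supp :: "('v set \<Rightarrow> real) \<Rightarrow> 'v set" where
  "supp G = {v. relevant G v}"

definition deg :: "('v set \<Rightarrow> real ^ 'e::finite) \<Rightarrow> 'v \<Rightarrow> nat" where
  "deg F v = card {e. v \<in> supp (component F e)}"

text \<open>The real power $D_F^p$ of the diagonal degree matrix; meaningful when all degrees are positive.\<close>

definition deg_matrix_powr :: "('v::finite set \<Rightarrow> real ^ 'e::finite) \<Rightarrow> real \<Rightarrow> real ^ 'v ^ 'v" where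
  "deg_matrix_powr F p = (\<chi> u v. if u = v then real (deg F v) powr p else 0)"

definition vol :: "('v::finite set \<Rightarrow> real ^ 'e::finite) \<Rightarrow> 'v set \<Rightarrow> real" where
  "vol F S = (\<Sum>v\<in>S. real (deg F v))"

definition cut :: "('v set \<Rightarrow> real ^ 'e::finite) \<Rightarrow> 'v set \<Rightarrow> real" where
  "cut F S = (\<Sum>e\<in>UNIV. component F e S)"

definition set_conductance :: "('v::finite set \<Rightarrow> real ^ 'e::finite) \<Rightarrow> 'v set \<Rightarrow> real" where
  "set_conductance F S = min (cut F S) (cut F (UNIV - S)) / min (vol F S) (vol F (UNIV - S))"

definition conductance :: "('v::finite set \<Rightarrow> real ^ 'e::finite) \<Rightarrow> real" where
  "conductance F = Min (set_conductance F ` {S. S \<noteq> {} \<and> S \<subset> UNIV})"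

definition laplacian ::
    "('v::finite set \<Rightarrow> real ^ 'e::finite) \<Rightarrow> real ^ 'v \<Rightarrow> (real ^ 'v) set" where
  "laplacian F x =
     {\<Sum>e\<in>UNIV. (w e \<bullet> x) *\<^sub>R w e | w. \<forall>e. w e \<in> lovasz_subdifferential (component F e) x}"

definition normalized_laplacian ::
    "('v::finite set \<Rightarrow> real ^ 'e::finite) \<Rightarrow> real ^ 'v \<Rightarrow> (real ^ 'v) set" where
  "normalized_laplacian F x =
     {deg_matrix_powr F (- 1 / 2) *v z | z. z \<in> laplacian F (deg_matrix_powr F (- 1 / 2) *v x)}"

definition nontrivial_eigenvalue :: "('v::finite set \<Rightarrow> real ^ 'e::finite) \<Rightarrow> real \<Rightarrow> bool" where
  "nontrivial_eigenvalue F l \<longleftrightarrow>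
     (\<exists>v. v \<noteq> 0 \<and> l *\<^sub>R v \<in> normalized_laplacian F v \<and>
          orthogonal v (deg_matrix_powr F (1 / 2) *v 1))"

definition lambda_F :: "('v::finite set \<Rightarrow> real ^ 'e::finite) \<Rightarrow> real" where
  "lambda_F F = (LEAST l. nontrivial_eigenvalue F l)"

end

theory Submission imports Defs begin

text \<open>
  The Laplacian is the subdifferential of half the convex energy \<open>\<Sum>\<^sub>e f\<^sub>e(x)\<^sup>2\<close>, so a minimizer of
  the Rayleigh quotient on the complement of \<open>D 1\<close> is an eigenvector (otherwise a separating
  hyperplane gives a descent direction), and \<open>\<lambda>\<close> is the minimal quotient. Centred indicator
  vectors as test vectors give \<open>\<lambda> / 2 \<le> \<phi>\<close>. Conversely, shift a minimizer by its weighted median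
  to \<open>y\<close> and let \<open>w\<^sub>e\<close> be the greedy base for the order of \<open>y\<close>, which is tight on all superlevel
  sets of \<open>y\<close>. The layer-cake formula bounds \<open>\<Sum>\<^sub>e \<langle>w\<^sub>e, y|y|\<rangle>\<close> from below by
  \<open>\<phi> \<Sum>\<^sub>v d(v) y(v)\<^sup>2\<close>. With \<open>M\<^sub>e\<close> bounding \<open>|y|\<close> on the support of \<open>F\<^sub>e\<close>, monotonicity of
  \<open>2 M\<^sub>e y - y|y|\<close> in \<open>y\<close> bounds it from above by \<open>\<Sum>\<^sub>e 2 M\<^sub>e f\<^sub>e(y)\<close>, and Cauchy--Schwarz finishes.
\<close>

section \<open>Layer-cake inequalities\<close>

text \<open>Finite form of writing the weighted sum as the integral over t > 0 of the mass of
  \<open>c\<close> on {z >= t}. The induction removes one layer at a time and runs on the number of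
  points where \<open>z\<close> is positive.\<close>

lemma sum_mult_nonneg_of_superlevel_nonneg:
  fixes c z :: "'a \<Rightarrow> real"
  assumes "finite A" "\<And>v. v \<in> A \<Longrightarrow> 0 \<le> z v"
    and "\<And>t. 0 < t \<Longrightarrow> 0 \<le> sum c {v \<in> A. t \<le> z v}"
  shows "0 \<le> (\<Sum>v\<in>A. c v * z v)"
  using assms(2,3)
proof (induction "card {v \<in> A. 0 < z v}" arbitrary: z rule: less_induct)
  case less
  let ?P = "{v \<in> A. 0 < z v}"
  have finP: "finite ?P" using assms(1) by auto
  show ?case
  proof (cases "?P = {}")
    case True
    then have "z v = 0" if "v \<in> A" for v
      using less.prems(1)[OF that] that by (metis (mono_tags, lifting) empty_iff mem_Collect_eq order_le_less)
    then show ?thesis by simp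
  next
    case False
    define m where "m = Min (z ` ?P)"
    have "m \<in> z ` ?P" unfolding m_def using finP False by (intro Min_in) auto
    then obtain p where p: "p \<in> A" "0 < z p" "m = z p" by auto
    have m_le: "m \<le> z v" if "v \<in> ?P" for v
      unfolding m_def using finP that by (intro Min_le) auto
    \<comment> \<open>Cut off the bottom layer, of height \<open>m\<close>: the level sets of
      \<open>z'\<close> at t > 0 are those of \<open>z\<close> at t + m, so the hypothesis passes to
      \<open>z'\<close>, and the layer itself contributes \<open>m * sum c ?P\<close>.\<close>
    define z' where "z' v = (if 0 < z v then z v - m else 0)" for v
    have level: "{v \<in> A. t \<le> z' v} = {v \<in> A. t + m \<le> z v}" if "0 < t" for t
      using that p by (auto simp: z'_def)
    have "card {v \<in> A. 0 < z' v} < card ?P"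
    proof (rule psubset_card_mono[OF finP])
      have "p \<in> ?P" "p \<notin> {v \<in> A. 0 < z' v}" using p by (auto simp: z'_def)
      then show "{v \<in> A. 0 < z' v} \<subset> ?P" by (auto simp: z'_def split: if_splits)
    qed
    moreover have "0 \<le> z' v" if "v \<in> A" for v
      using m_le[of v] that by (auto simp: z'_def)
    moreover have "0 \<le> sum c {v \<in> A. t \<le> z' v}" if "0 < t" for t
      unfolding level[OF that] using less.prems(2) that p by simp
    ultimately have "0 \<le> (\<Sum>v\<in>A. c v * z' v)" by (rule less.hyps)
    moreover have "?P = {v \<in> A. m \<le> z v}" using m_le p by auto
    then have "0 \<le> sum c ?P" using less.prems(2)[of m] p by simp
    moreover have "(\<Sum>v\<in>A. c v * z v) = (\<Sum>v\<in>A. c v * z' v) + m * sum c ?P"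
    proof -
      have "sum c ?P = (\<Sum>v\<in>A. if 0 < z v then c v else 0)"
        using assms(1) by (simp add: sum.inter_filter)
      then have "(\<Sum>v\<in>A. c v * z' v) + m * sum c ?P
          = (\<Sum>v\<in>A. c v * z' v + m * (if 0 < z v then c v else 0))"
        by (simp add: sum_distrib_left sum.distrib)
      also have "\<dots> = (\<Sum>v\<in>A. c v * z v)"
        using less.prems(1) by (intro sum.cong) (force simp: z'_def algebra_simps not_less)+
      finally show ?thesis ..
    qed
    ultimately show ?thesis using p by simp
  qed
qed

text \<open>Total mass zero makes the sum invariant under shifting \<open>z\<close> by a constant,
  so \<open>z\<close> may be assumed nonnegative.\<close>

lemma sum_mult_nonneg_of_superlevel:
  fixes c z :: "'a::finite \<Rightarrow> real"
  assumes "sum c UNIV = 0" and "\<And>t. 0 \<le> sum c {v. t \<le> z v}"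
  shows "0 \<le> (\<Sum>v\<in>UNIV. c v * z v)"
proof -
  define m where "m = Min (range z)"
  have "0 \<le> (\<Sum>v\<in>UNIV. c v * (z v - m))"
  proof (rule sum_mult_nonneg_of_superlevel_nonneg)
    show "0 \<le> z v - m" for v by (simp add: m_def)
    show "0 \<le> sum c {v \<in> UNIV. t \<le> z v - m}" for t
      using assms(2)[of "t + m"] by (simp add: algebra_simps)
  qed simp
  also have "\<dots> = (\<Sum>v\<in>UNIV. c v * z v) - m * sum c UNIV"
    by (simp add: algebra_simps sum_subtractf sum_distrib_left)
  finally show ?thesis using assms(1) by simp
qed

section \<open>The base polytope and the greedy algorithm\<close>

text \<open>On a finite type these are the empty set and the superlevel sets of \<open>y\<close>;
  using \<le> keeps ties together, so no tie-breaking order is needed.\<close>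

definition upper_for :: "('v \<Rightarrow> real) \<Rightarrow> 'v set \<Rightarrow> bool" where
  "upper_for y U \<longleftrightarrow> (\<forall>v\<in>U. \<forall>u. y v \<le> y u \<longrightarrow> u \<in> U)"

text \<open>Edmonds' greedy algorithm: elements enter in decreasing order of \<open>y\<close>, and
  each receives its marginal increment of \<open>G\<close>. Submodularity says that the increment
  over a smaller set is at least as large, which preserves the upper bounds.\<close>

lemma greedy_on:
  fixes G :: "'v set \<Rightarrow> real" and y :: "'v \<Rightarrow> real"
  assumes "submodular G" "G {} = 0" "finite A"
  shows "\<exists>w. (\<forall>S\<subseteq>A. sum w S \<le> G S) \<and>
             (\<forall>U\<subseteq>A. (\<forall>v\<in>U. \<forall>u\<in>A. y v \<le> y u \<longrightarrow> u \<in> U) \<longrightarrow> sum w U = G U)"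
  using assms(3)
proof (induction A rule: finite_ranking_induct[where f = "\<lambda>v. - y v"])
  case empty
  then show ?case using assms(2) by simp
next
  case (insert x A)
  show ?case
  proof (cases "x \<in> A")
    case True
    then show ?thesis using insert.IH by (simp add: insert_absorb)
  next
    case False
    from insert.IH obtain w where w: "\<And>S. S \<subseteq> A \<Longrightarrow> sum w S \<le> G S"
      "\<And>U. U \<subseteq> A \<Longrightarrow> (\<forall>v\<in>U. \<forall>u\<in>A. y v \<le> y u \<longrightarrow> u \<in> U) \<Longrightarrow> sum w U = G U"
      by blast
    define w' where "w' = w(x := G (insert x A) - G A)"
    have w'_out: "sum w' S = sum w S" if "x \<notin> S" for S
      unfolding w'_def using that by (intro sum.cong) auto
    have w'_in: "sum w' S = sum w (S - {x}) + (G (insert x A) - G A)"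
      if "x \<in> S" "S \<subseteq> insert x A" for S
    proof -
      have "finite S" using that(2) insert.hyps(1) by (meson finite_insert finite_subset)
      then have "sum w' S = w' x + sum w' (S - {x})" using that(1) by (rule sum.remove)
      then show ?thesis using w'_out[of "S - {x}"] by (simp add: w'_def)
    qed
    have "sum w' S \<le> G S" if S: "S \<subseteq> insert x A" for S
    proof (cases "x \<in> S")
      case True
      have "G (S \<union> A) + G (S \<inter> A) \<le> G S + G A"
        using assms(1) by (simp add: submodular_def)
      moreover have "S \<union> A = insert x A" "S \<inter> A = S - {x}" using S True False by auto
      moreover have "sum w (S - {x}) \<le> G (S - {x})" using S by (intro w(1)) auto
      ultimately show ?thesis using w'_in[OF True S] by simp
    next
      case False
      then show ?thesis using w'_out[OF False] w(1)[of S] S by auto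
    qed
    moreover have "sum w' U = G U"
      if U: "U \<subseteq> insert x A" "\<forall>v\<in>U. \<forall>u\<in>insert x A. y v \<le> y u \<longrightarrow> u \<in> U" for U
    proof (cases "x \<in> U")
      case True
      \<comment> \<open>The ranking induction gives \<open>x\<close> the least value of
        \<open>y\<close>, so an upper set containing \<open>x\<close> is everything.\<close>
      have "U = insert x A" using U True insert.hyps(2) by fastforce
      moreover have "insert x A - {x} = A" using False by auto
      moreover have "sum w A = G A" by (rule w(2)) auto
      ultimately show ?thesis using w'_in[OF True U(1)] by simp
    next
      case False
      have "sum w U = G U" using U False by (intro w(2)) auto
      then show ?thesis using w'_out[OF False] by simp
    qed
    ultimately show ?thesis by blast
  qed
qed

lemma greedy_base:
  fixes G :: "'v::finite set \<Rightarrow> real"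
  assumes "submodular G" "G {} = 0"
  obtains w where "w \<in> base_polytope G" "\<And>U. upper_for y U \<Longrightarrow> (\<Sum>v\<in>U. w $ v) = G U"
proof -
  obtain w where w: "\<And>S. sum w S \<le> G S" "\<And>U. upper_for y U \<Longrightarrow> sum w U = G U"
    using greedy_on[OF assms, of UNIV y] by (auto simp: upper_for_def)
  have "upper_for y UNIV" by (simp add: upper_for_def)
  then show ?thesis
    using w by (intro that[of "\<chi> v. w v"]) (auto simp: base_polytope_def)
qed

text \<open>The lower bound comes from the total and the constraint on the complement of v. These
  bounds give compactness, and later force bases to vanish outside the support.\<close>

lemma base_polytope_bounds:
  assumes "w \<in> base_polytope G"
  shows "w $ v \<le> G {v}" "G UNIV - G (UNIV - {v}) \<le> w $ v"
proof -
  have le: "(\<Sum>u\<in>S. w $ u) \<le> G S" for S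
    using assms by (simp add: base_polytope_def)
  show "w $ v \<le> G {v}" using le[of "{v}"] by simp
  have "(\<Sum>u\<in>UNIV. w $ u) = w $ v + (\<Sum>u\<in>UNIV - {v}. w $ u)"
    by (rule sum.remove) auto
  then show "G UNIV - G (UNIV - {v}) \<le> w $ v"
    using assms le[of "UNIV - {v}"] unfolding base_polytope_def mem_Collect_eq by linarith
qed

section \<open>Compactness and convexity of the base polytope\<close>

lemma closed_base_polytope: "closed (base_polytope G)"
  unfolding base_polytope_def
  by (intro closed_Collect_conj closed_Collect_all closed_Collect_le closed_Collect_eq continuous_intros)

lemma convex_base_polytope: "convex (base_polytope G)"
proof (rule convexI)
  fix x y and u v :: real
  assume xy: "x \<in> base_polytope G" "y \<in> base_polytope G" and uv: "0 \<le> u" "0 \<le> v" "u + v = 1"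
  have eq: "(\<Sum>i\<in>S. (u *\<^sub>R x + v *\<^sub>R y) $ i) = u * (\<Sum>i\<in>S. x $ i) + v * (\<Sum>i\<in>S. y $ i)" for S
    by (simp add: sum.distrib sum_distrib_left)
  have "u * (\<Sum>i\<in>S. x $ i) + v * (\<Sum>i\<in>S. y $ i) \<le> u * G S + v * G S" for S
    using xy uv by (intro add_mono mult_left_mono) (auto simp: base_polytope_def)
  moreover have "u * a + v * a = a" for a
    using uv(3) by (metis distrib_right mult_1)
  ultimately show "u *\<^sub>R x + v *\<^sub>R y \<in> base_polytope G"
    using xy unfolding base_polytope_def mem_Collect_eq eq by metis
qed

lemma compact_base_polytope: "compact (base_polytope G)"
proof -
  have "base_polytope G \<subseteq> cbox (\<chi> v. G UNIV - G (UNIV - {v})) (\<chi> v. G {v})"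
    using base_polytope_bounds by (auto simp: mem_box_cart)
  then show ?thesis
    using closed_base_polytope bounded_cbox bounded_subset compact_eq_bounded_closed by blast
qed

section \<open>The Lovasz extension as an attained maximum\<close>

lemma inner_le_lovasz_extension:
  assumes "w \<in> base_polytope G"
  shows "w \<bullet> x \<le> lovasz_extension G x"
  unfolding lovasz_extension_def
proof (rule cSUP_upper[OF assms])
  have "compact ((\<lambda>w. w \<bullet> x) ` base_polytope G)"
    by (intro compact_continuous_image compact_base_polytope continuous_intros)
  then show "bdd_above ((\<lambda>w. w \<bullet> x) ` base_polytope G)"
    by (simp add: bounded_imp_bdd_above compact_imp_bounded)
qed

lemma mem_lovasz_subdifferential_iff:
  "w \<in> lovasz_subdifferential G x \<longleftrightarrow> w \<in> base_polytope G \<and> w \<bullet> x = lovasz_extension G x"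
proof
  assume "w \<in> lovasz_subdifferential G x"
  then show "w \<in> base_polytope G \<and> w \<bullet> x = lovasz_extension G x"
    using lovasz_subdifferential_attains by (auto simp: lovasz_subdifferential_def is_arg_max_def)
next
  assume "w \<in> base_polytope G \<and> w \<bullet> x = lovasz_extension G x"
  then show "w \<in> lovasz_subdifferential G x"
    using inner_le_lovasz_extension[of _ G x]
    by (auto simp: lovasz_subdifferential_def is_arg_max_def not_less)
qed

lemma lovasz_subdifferential_nonempty:
  assumes "base_polytope G \<noteq> {}"
  obtains w where "w \<in> lovasz_subdifferential G x"
proof -
  have "continuous_on (base_polytope G) (\<lambda>w. w \<bullet> x)" by (intro continuous_intros)
  from continuous_attains_sup[OF compact_base_polytope assms this]
  obtain w where "w \<in> base_polytope G" "\<forall>u\<in>base_polytope G. u \<bullet> x \<le> w \<bullet> x" by blast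
  then show ?thesis
    by (intro that[of w]) (auto simp: lovasz_subdifferential_def is_arg_max_def not_less)
qed

text \<open>A maximum of linear functions is convex: a maximizer at the intermediate point is a
  competitor at both ends. In finite dimension convexity on an open set gives continuity.\<close>

lemma continuous_lovasz_extension:
  assumes "base_polytope G \<noteq> {}"
  shows "continuous_on UNIV (lovasz_extension G)"
proof (rule convex_on_continuous[OF open_UNIV], rule convex_onI)
  fix t :: real and x y assume t: "0 < t" "t < 1"
  obtain w where "w \<in> lovasz_subdifferential G ((1 - t) *\<^sub>R x + t *\<^sub>R y)"
    using lovasz_subdifferential_nonempty[OF assms] .
  then have w: "w \<in> base_polytope G"
    "lovasz_extension G ((1 - t) *\<^sub>R x + t *\<^sub>R y) = (1 - t) * (w \<bullet> x) + t * (w \<bullet> y)"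
    by (auto simp: mem_lovasz_subdifferential_iff inner_simps dest: sym)
  have "(1 - t) * (w \<bullet> x) + t * (w \<bullet> y)
      \<le> (1 - t) * lovasz_extension G x + t * lovasz_extension G y"
    using t w(1) by (intro add_mono mult_left_mono inner_le_lovasz_extension) auto
  then show "lovasz_extension G ((1 - t) *\<^sub>R x + t *\<^sub>R y)
      \<le> (1 - t) * lovasz_extension G x + t * lovasz_extension G y"
    using w(2) by simp
qed simp

text \<open>Bases sum to zero and so are orthogonal to the all-ones vector \<open>1\<close>. This is
  what permits centring and the median shift.\<close>

lemma lovasz_extension_add_const:
  assumes "base_polytope G \<noteq> {}" "G UNIV = 0"
  shows "lovasz_extension G (x + c *\<^sub>R 1) = lovasz_extension G x"
  unfolding lovasz_extension_def
proof (rule SUP_cong)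
  fix w assume "w \<in> base_polytope G"
  then have "w \<bullet> 1 = 0" using assms(2) by (simp add: base_polytope_def inner_vec_def)
  then show "w \<bullet> (x + c *\<^sub>R 1) = w \<bullet> x" by (simp add: inner_simps)
qed simp

lemma lovasz_extension_scaleR:
  assumes "base_polytope G \<noteq> {}" "0 \<le> c"
  shows "lovasz_extension G (c *\<^sub>R x) = c * lovasz_extension G x"
proof (rule antisym)
  obtain w where "w \<in> lovasz_subdifferential G (c *\<^sub>R x)"
    using lovasz_subdifferential_nonempty[OF assms(1)] .
  then have "w \<in> base_polytope G" "lovasz_extension G (c *\<^sub>R x) = c * (w \<bullet> x)"
    by (auto simp: mem_lovasz_subdifferential_iff dest: sym)
  then show "lovasz_extension G (c *\<^sub>R x) \<le> c * lovasz_extension G x"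
    using assms(2) by (simp add: inner_le_lovasz_extension mult_left_mono)
next
  obtain w where "w \<in> lovasz_subdifferential G x"
    using lovasz_subdifferential_nonempty[OF assms(1)] .
  then have "w \<in> base_polytope G" "c * lovasz_extension G x = w \<bullet> (c *\<^sub>R x)"
    by (auto simp: mem_lovasz_subdifferential_iff dest: sym)
  then show "c * lovasz_extension G x \<le> lovasz_extension G (c *\<^sub>R x)"
    by (simp only: inner_le_lovasz_extension)
qed

section \<open>The degree inner product\<close>

text \<open>The Euclidean product after the substitution v = D^(1/2) x; orthogonality of v to
  D^(1/2) 1 becomes \<open>deg_inner F x 1 = 0\<close>.\<close>

definition deg_inner :: "('v::finite set \<Rightarrow> real ^ 'e::finite) \<Rightarrow> real ^ 'v \<Rightarrow> real ^ 'v \<Rightarrow> real" where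
  "deg_inner F x y = (\<Sum>v\<in>UNIV. real (deg F v) * x $ v * y $ v)"

definition energy :: "('v::finite set \<Rightarrow> real ^ 'e::finite) \<Rightarrow> real ^ 'v \<Rightarrow> real" where
  "energy F x = (\<Sum>e\<in>UNIV. (lovasz_extension (component F e) x)\<^sup>2)"

lemma deg_inner_commute: "deg_inner F x y = deg_inner F y x"
  by (simp add: deg_inner_def mult_ac)

lemma deg_inner_add_left: "deg_inner F (x + y) z = deg_inner F x z + deg_inner F y z"
  by (simp add: deg_inner_def algebra_simps sum.distrib)

lemma deg_inner_scaleR_left: "deg_inner F (c *\<^sub>R x) y = c * deg_inner F x y"
  by (simp add: deg_inner_def sum_distrib_left mult_ac)

lemma deg_inner_add_right: "deg_inner F z (x + y) = deg_inner F z x + deg_inner F z y"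
  by (simp add: deg_inner_def algebra_simps sum.distrib)

lemma deg_inner_scaleR_right: "deg_inner F y (c *\<^sub>R x) = c * deg_inner F y x"
  by (simp add: deg_inner_def sum_distrib_left mult_ac)

lemma deg_inner_diff_left: "deg_inner F (x - y) z = deg_inner F x z - deg_inner F y z"
  by (simp add: deg_inner_def algebra_simps sum_subtractf)

lemma deg_inner_diff_right: "deg_inner F z (x - y) = deg_inner F z x - deg_inner F z y"
  by (simp add: deg_inner_def algebra_simps sum_subtractf)

lemmas deg_inner_simps =
  deg_inner_add_left deg_inner_add_right deg_inner_diff_left deg_inner_diff_right
  deg_inner_scaleR_left deg_inner_scaleR_right

lemma deg_inner_nonneg: "0 \<le> deg_inner F x x"
  unfolding deg_inner_def by (intro sum_nonneg) (simp add: mult.assoc)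

lemma continuous_on_deg_inner [continuous_intros]:
  assumes "continuous_on S f" "continuous_on S g"
  shows "continuous_on S (\<lambda>x. deg_inner F (f x) (g x))"
  unfolding deg_inner_def by (intro continuous_intros assms)

lemma deg_matrix_powr_mult: "deg_matrix_powr F p *v x = (\<chi> v. real (deg F v) powr p * x $ v)"
  by (simp add: deg_matrix_powr_def matrix_vector_mult_def vec_eq_iff if_distrib[of "\<lambda>a. a * _"]
      sum.delta cong: if_cong)

section \<open>The smallest non-trivial eigenvalue as a minimal Rayleigh quotient\<close>

locale bounded_submodular_transformation =
  fixes F :: "'v::finite set \<Rightarrow> real ^ 'e::finite"
  assumes submodular: "submodular_transformation F"
    and empty: "F {} = 0" and UNIV: "F UNIV = 0"
    and range: "\<And>S e. F S $ e \<in> {0..1}"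
    and deg_pos: "\<And>v. 0 < deg F v"
begin

abbreviation "f e \<equiv> lovasz_extension (component F e)"
abbreviation "B e \<equiv> base_polytope (component F e)"
abbreviation "d v \<equiv> real (deg F v)"

section \<open>Positivity, homogeneity and shift invariance of the energy\<close>

lemma component_simps [simp]: "component F e {} = 0" "component F e UNIV = 0"
  by (simp_all add: component_def empty UNIV)

lemma component_bounds: "0 \<le> component F e S" "component F e S \<le> 1"
  using range[of S e] by (simp_all add: component_def)

lemma submodular_component: "submodular (component F e)"
  using submodular by (simp add: submodular_transformation_def)

lemma zero_in_base: "0 \<in> B e"
  using component_bounds by (simp add: base_polytope_def)

lemma base_nonempty: "B e \<noteq> {}"
  using zero_in_base by blast

lemma base_sum: "w \<in> B e \<Longrightarrow> (\<Sum>v\<in>UNIV. w $ v) = 0"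
  by (simp add: base_polytope_def)

lemma base_inner_one: "w \<in> B e \<Longrightarrow> w \<bullet> 1 = 0"
  by (simp add: base_polytope_def inner_vec_def)

lemma f_nonneg: "0 \<le> f e x"
  using inner_le_lovasz_extension[OF zero_in_base, where x = x] by simp

lemma energy_nonneg: "0 \<le> energy F x"
  by (simp add: energy_def sum_nonneg)

lemma energy_add_const: "energy F (x + c *\<^sub>R 1) = energy F x"
  by (simp add: energy_def lovasz_extension_add_const base_nonempty)

lemma energy_scaleR: "0 \<le> c \<Longrightarrow> energy F (c *\<^sub>R x) = c\<^sup>2 * energy F x"
  by (simp add: energy_def lovasz_extension_scaleR base_nonempty power_mult_distrib sum_distrib_left)

lemma continuous_energy: "continuous_on UNIV (energy F)"
  unfolding energy_def by (intro continuous_intros continuous_lovasz_extension base_nonempty)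

lemma deg_ge_1: "1 \<le> d v"
  using deg_pos[of v] by linarith

lemma norm_le_deg_inner: "(norm x)\<^sup>2 \<le> deg_inner F x x"
proof -
  have "x $ v * x $ v \<le> d v * x $ v * x $ v" for v
    using mult_right_mono[OF deg_ge_1[of v], of "x $ v * x $ v"] by (simp add: mult.assoc)
  then show ?thesis
    unfolding power2_norm_eq_inner deg_inner_def inner_vec_def by (intro sum_mono) simp
qed

lemma deg_inner_pos: "x \<noteq> 0 \<Longrightarrow> 0 < deg_inner F x x"
  using norm_le_deg_inner[of x] by (smt (verit) norm_eq_zero zero_less_power2)

text \<open>The projection, orthogonal for \<open>deg_inner\<close>, onto the complement of the
  all-ones vector.\<close>

definition center :: "real ^ 'v \<Rightarrow> real ^ 'v" where
  "center x = x + (- (deg_inner F x 1 / deg_inner F 1 1)) *\<^sub>R 1"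

lemma deg_inner_center: "deg_inner F (center x) 1 = 0"
  using deg_inner_pos[of 1] by (simp add: center_def deg_inner_simps)

lemma energy_center: "energy F (center x) = energy F x"
  unfolding center_def by (rule energy_add_const)

lemma deg_inner_center_center:
  "deg_inner F (center x) (center x) = deg_inner F x x - (deg_inner F x 1)\<^sup>2 / deg_inner F 1 1"
proof -
  have "deg_inner F (center x) (center x) = deg_inner F (center x) x"
    using deg_inner_center[of x] by (subst (2) center_def) (simp add: deg_inner_simps)
  then show ?thesis
    using deg_inner_commute[of F 1 x]
    by (simp add: center_def deg_inner_simps power2_eq_square)
qed

text \<open>With a single vertex no element would be relevant, contradicting positivity of the degrees.\<close>

lemma two_vertices: obtains p q :: 'v where "p \<noteq> q"
proof (rule ccontr)
  assume "\<not> thesis"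
  then have single: "p = q" for p q :: 'v using that by blast
  obtain v :: 'v where True by blast
  have *: "UNIV = {v}" using single by auto
  have "component F e S = 0" for e S
    using single * component_simps[of e] by (metis UNIV_I subset_singletonD top_greatest)
  then have "supp (component F e) = {}" for e by (simp add: supp_def relevant_def)
  then have "deg F v = 0" by (simp add: deg_def)
  then show False using deg_pos[of v] by simp
qed

text \<open>The unit sphere of \<open>deg_inner\<close> inside the complement of \<open>1\<close> is
  compact because degrees are at least 1, and nonempty because there are two vertices. Both forms
  are homogeneous of degree 2, which extends the bound from the sphere.\<close>

lemma rayleigh_minimizer:
  obtains x where "deg_inner F x x = 1" "deg_inner F x 1 = 0"
    "\<And>y. deg_inner F y 1 = 0 \<Longrightarrow> energy F x * deg_inner F y y \<le> energy F y"
proof -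
  define S where "S = {x. deg_inner F x x = 1 \<and> deg_inner F x 1 = 0}"
  have normalize: "(1 / sqrt (deg_inner F y y)) *\<^sub>R y \<in> S" if "y \<noteq> 0" "deg_inner F y 1 = 0" for y
    using that deg_inner_pos[OF that(1)] by (simp add: S_def deg_inner_simps)
  have "closed S"
    unfolding S_def by (intro closed_Collect_conj closed_Collect_eq continuous_intros)
  moreover have "bounded S"
  proof (rule boundedI)
    fix x assume "x \<in> S"
    then have "(norm x)\<^sup>2 \<le> 1\<^sup>2" using norm_le_deg_inner[of x] by (simp add: S_def)
    then show "norm x \<le> 1" by (rule power2_le_imp_le) simp
  qed
  ultimately have "compact S" by (simp add: compact_eq_bounded_closed)
  moreover have "S \<noteq> {}"
  proof -
    obtain p q :: 'v where "p \<noteq> q" using two_vertices .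
    then have "center (axis p 1) $ q = - (d p / deg_inner F 1 1)"
      by (simp add: center_def axis_def deg_inner_def if_distrib if_distribR cong: if_cong)
    then have "center (axis p 1) \<noteq> 0"
      using deg_pos[of p] deg_inner_pos[of 1] by (metis divide_eq_0_iff neg_equal_0_iff_equal
          of_nat_eq_0_iff order_less_irrefl zero_index zero_neq_one)
    then show ?thesis using normalize deg_inner_center by blast
  qed
  moreover have "continuous_on S (energy F)"
    using continuous_energy continuous_on_subset by blast
  ultimately obtain x where x: "x \<in> S" "\<And>y. y \<in> S \<Longrightarrow> energy F x \<le> energy F y"
    using continuous_attains_inf by metis
  have "energy F x * deg_inner F y y \<le> energy F y" if y: "deg_inner F y 1 = 0" for y
  proof (cases "y = 0")
    case True
    then show ?thesis by (simp add: deg_inner_def energy_nonneg)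
  next
    case False
    have "energy F x \<le> energy F ((1 / sqrt (deg_inner F y y)) *\<^sub>R y)"
      using x(2) normalize[OF False y] .
    also have "\<dots> = energy F y / deg_inner F y y"
      using deg_inner_nonneg[of F y] by (simp add: energy_scaleR power_divide)
    finally show ?thesis using deg_inner_pos[OF False] by (simp add: field_simps)
  qed
  then show ?thesis using that x(1) by (auto simp: S_def)
qed

text \<open>Maximizers all have the same pairing with \<open>x\<close>, so the quadratic expression
  becomes linear in the bases. Storing the family as a matrix places it in a Euclidean space, where
  compactness arguments apply.\<close>

lemma laplacian_alt:
  "laplacian F x = {\<Sum>e\<in>UNIV. f e x *\<^sub>R W $ e | W. \<forall>e. W $ e \<in> lovasz_subdifferential (component F e) x}"
    (is "_ = ?R")
proof (intro subset_antisym subsetI)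
  fix z assume "z \<in> laplacian F x"
  then obtain w where w: "\<And>e. w e \<in> lovasz_subdifferential (component F e) x"
    "z = (\<Sum>e\<in>UNIV. (w e \<bullet> x) *\<^sub>R w e)"
    by (auto simp: laplacian_def)
  have "z = (\<Sum>e\<in>UNIV. f e x *\<^sub>R (\<chi> e. w e) $ e)"
    using w(2) by (simp add: lovasz_subdifferential_attains[OF w(1)])
  then show "z \<in> ?R" using w(1) by (intro CollectI exI[of _ "\<chi> e. w e"]) simp
next
  fix z assume "z \<in> ?R"
  then obtain W where W: "\<And>e. W $ e \<in> lovasz_subdifferential (component F e) x"
    "z = (\<Sum>e\<in>UNIV. f e x *\<^sub>R W $ e)"
    by auto
  have "z = (\<Sum>e\<in>UNIV. (W $ e \<bullet> x) *\<^sub>R W $ e)"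
    using W(2) by (simp add: lovasz_subdifferential_attains[OF W(1)])
  then show "z \<in> laplacian F x"
    unfolding laplacian_def using W(1) by (intro CollectI exI[of _ "($) W"]) simp
qed

lemma compact_base_product: "compact {W :: real ^ 'v ^ 'e. \<forall>e. W $ e \<in> B e}"
proof -
  have "closed {W :: real ^ 'v ^ 'e. \<forall>e. W $ e \<in> B e}"
    by (intro closed_Collect_all continuous_closed_vimage[of _ "\<lambda>W. W $ _", unfolded vimage_def]
        closed_base_polytope continuous_intros)
  moreover have "bounded {W :: real ^ 'v ^ 'e. \<forall>e. W $ e \<in> B e}"
  proof -
    have "\<exists>b. \<forall>w\<in>B e. norm w \<le> b" for e
      using compact_imp_bounded[OF compact_base_polytope] by (simp add: bounded_iff)
    then obtain b where b: "\<And>e w. w \<in> B e \<Longrightarrow> norm w \<le> b e" by metis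
    have "norm W \<le> sum b UNIV" if "\<forall>e. W $ e \<in> B e" for W :: "real ^ 'v ^ 'e"
    proof -
      have "norm W \<le> (\<Sum>e\<in>UNIV. norm (W $ e))"
        unfolding norm_vec_def by (rule L2_set_le_sum) simp
      also have "\<dots> \<le> sum b UNIV" using that b by (intro sum_mono) blast
      finally show ?thesis .
    qed
    then show ?thesis by (intro boundedI) blast
  qed
  ultimately show ?thesis by (simp add: compact_eq_bounded_closed)
qed

lemma laplacian_inner_one:
  assumes "z \<in> laplacian F x"
  shows "z \<bullet> 1 = 0"
proof -
  obtain W where W: "\<And>e. W $ e \<in> B e" "z = (\<Sum>e\<in>UNIV. f e x *\<^sub>R W $ e)"
    using assms by (auto simp: laplacian_alt mem_lovasz_subdifferential_iff)
  then show ?thesis by (simp add: inner_sum_left base_inner_one[OF W(1)])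
qed

text \<open>A linear image of a product of faces of base polytopes. Convexity and closedness are
  what the separating hyperplane needs.\<close>

lemma convex_compact_laplacian: "convex (laplacian F x)" "compact (laplacian F x)"
proof -
  let ?T = "\<lambda>W :: real ^ 'v ^ 'e. \<Sum>e\<in>UNIV. f e x *\<^sub>R W $ e"
  let ?C = "{W. \<forall>e. W $ e \<in> lovasz_subdifferential (component F e) x}"
  have img: "laplacian F x = ?T ` ?C" by (auto simp: laplacian_alt)
  have C: "?C = {W. \<forall>e. W $ e \<in> B e} \<inter> {W. \<forall>e. W $ e \<bullet> x = f e x}"
    by (auto simp: mem_lovasz_subdifferential_iff)
  have lin: "linear ?T"
    by (rule linearI) (simp_all add: algebra_simps sum.distrib scaleR_sum_right)
  have "convex ?C"
  proof (rule convexI)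
    fix W W' and u v :: real
    assume *: "W \<in> ?C" "W' \<in> ?C" "0 \<le> u" "0 \<le> v" "u + v = 1"
    have "u *\<^sub>R W $ e + v *\<^sub>R W' $ e \<in> B e" for e
      using * by (intro convexD[OF convex_base_polytope]) (auto simp: mem_lovasz_subdifferential_iff)
    moreover have "u * f e x + v * f e x = f e x" for e
      using *(5) by (metis distrib_right mult_1)
    ultimately show "u *\<^sub>R W + v *\<^sub>R W' \<in> ?C"
      using * by (auto simp: mem_lovasz_subdifferential_iff inner_simps)
  qed
  then show "convex (laplacian F x)" unfolding img by (rule convex_linear_image[OF lin])
  have "closed {W :: real ^ 'v ^ 'e. \<forall>e. W $ e \<bullet> x = f e x}"
    by (intro closed_Collect_all closed_Collect_eq continuous_intros)
  then have "compact ?C" unfolding C by (intro compact_Int_closed compact_base_product)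
  then show "compact (laplacian F x)"
    unfolding img by (intro compact_continuous_image continuous_intros)
qed

text \<open>Subgradients of half the energy at \<open>x + t h\<close> accumulate, as \<open>t\<close> tends to 0, at a
  subgradient at \<open>x\<close>; along \<open>h\<close> they dominate the difference quotients of the energy, hence
  those of the quadratic form that touches it from below at \<open>x\<close>.\<close>

lemma laplacian_dominates_direction:
  assumes min: "\<And>y. deg_inner F y 1 = 0 \<Longrightarrow> l * deg_inner F y y \<le> energy F y"
    and x: "energy F x = l * deg_inner F x x" "deg_inner F x 1 = 0"
    and h: "deg_inner F h 1 = 0" and l: "0 \<le> l"
  obtains z where "z \<in> laplacian F x" "l * deg_inner F x h \<le> z \<bullet> h"
proof -
  define t where "t n = inverse (real (Suc n))" for n
  have t_pos: "0 < t n" for n by (simp add: t_def)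
  define y where "y n = x + t n *\<^sub>R h" for n
  have "t \<longlonglongrightarrow> 0" unfolding t_def by (rule LIMSEQ_inverse_real_of_nat)
  then have y_lim: "y \<longlonglongrightarrow> x"
    unfolding y_def by (auto intro!: tendsto_eq_intros)
  have "\<exists>W. \<forall>e. W $ e \<in> lovasz_subdifferential (component F e) (y n)" for n
  proof -
    have "\<exists>w. w \<in> lovasz_subdifferential (component F e) (y n)" for e
      using lovasz_subdifferential_nonempty[OF base_nonempty] by metis
    then obtain w where "\<And>e. w e \<in> lovasz_subdifferential (component F e) (y n)" by metis
    then show ?thesis by (intro exI[of _ "\<chi> e. w e"]) simp
  qed
  then obtain W where W: "\<And>n e. W n $ e \<in> lovasz_subdifferential (component F e) (y n)" by metis
  have WB: "W n $ e \<in> B e" and Wf: "W n $ e \<bullet> y n = f e (y n)" for n e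
    using W[of n e] by (auto simp: mem_lovasz_subdifferential_iff)
  have step: "l * deg_inner F x h \<le> (\<Sum>e\<in>UNIV. f e (y n) * (W n $ e \<bullet> h))" for n
  proof -
    have "(f e (y n))\<^sup>2 - 2 * t n * (f e (y n) * (W n $ e \<bullet> h)) \<le> (f e x)\<^sup>2" for e
    proof -
      have "W n $ e \<bullet> x = f e (y n) - t n * (W n $ e \<bullet> h)"
        using Wf[of n e] by (simp add: y_def inner_simps)
      then have "f e (y n) - t n * (W n $ e \<bullet> h) \<le> f e x"
        using inner_le_lovasz_extension[OF WB, of n e x] by simp
      \<comment> \<open>With a = f e (y n), b = f e x and s = W n $ e \<bullet> h, the bound a (a -
        t s) \<le> a b combines with 2 a b \<le> a^2 + b^2.\<close>
      from mult_left_mono[OF this f_nonneg[of e "y n"]]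
      show ?thesis
        using zero_le_power2[of "f e x - f e (y n)"] by (simp add: power2_eq_square algebra_simps)
    qed
    then have "(\<Sum>e\<in>UNIV. (f e (y n))\<^sup>2 - 2 * t n * (f e (y n) * (W n $ e \<bullet> h))) \<le> energy F x"
      unfolding energy_def by (intro sum_mono)
    then have "energy F (y n) - 2 * t n * (\<Sum>e\<in>UNIV. f e (y n) * (W n $ e \<bullet> h)) \<le> energy F x"
      by (simp add: energy_def sum_subtractf sum_distrib_left)
    moreover have "l * deg_inner F (y n) (y n) \<le> energy F (y n)"
      by (rule min) (simp add: y_def deg_inner_simps x h)
    moreover have "deg_inner F (y n) (y n)
        = deg_inner F x x + 2 * t n * deg_inner F x h + (t n)\<^sup>2 * deg_inner F h h"
      by (simp add: y_def deg_inner_simps deg_inner_commute[of F h x] power2_eq_square algebra_simps)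
    \<comment> \<open>The second-order term has a favourable sign and is dropped, so dividing by
      \<open>2 * t n\<close> leaves no error term.\<close>
    moreover have "0 \<le> l * ((t n)\<^sup>2 * deg_inner F h h)"
      using l deg_inner_nonneg by (intro mult_nonneg_nonneg) auto
    ultimately have "2 * t n * (l * deg_inner F x h)
        \<le> 2 * t n * (\<Sum>e\<in>UNIV. f e (y n) * (W n $ e \<bullet> h))"
      using x(1) by (simp add: algebra_simps)
    then show ?thesis using t_pos[of n] by simp
  qed
  have "seq_compact {W :: real ^ 'v ^ 'e. \<forall>e. W $ e \<in> B e}"
    using compact_base_product compact_imp_seq_compact by blast
  then obtain W0 r where W0: "W0 \<in> {W :: real ^ 'v ^ 'e. \<forall>e. W $ e \<in> B e}" "strict_mono r" "(W \<circ> r) \<longlonglongrightarrow> W0"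
    using WB by (elim seq_compactE[where f = W]) auto
  have yr: "(\<lambda>n. y (r n)) \<longlonglongrightarrow> x"
    using LIMSEQ_subseq_LIMSEQ[OF y_lim W0(2)] by (simp add: o_def)
  have Wr: "(\<lambda>n. W (r n) $ e) \<longlonglongrightarrow> W0 $ e" for e
    using W0(3) by (auto simp: o_def intro: tendsto_vec_nth)
  have fr: "(\<lambda>n. f e (y (r n))) \<longlonglongrightarrow> f e x" for e
    using continuous_on_tendsto_compose[OF continuous_lovasz_extension[OF base_nonempty] yr] by simp
  \<comment> \<open>Passing to the limit in \<open>Wf\<close> shows that the limiting base is still
    a maximizer at \<open>x\<close>.\<close>
  have "(\<lambda>n. W (r n) $ e \<bullet> y (r n)) \<longlonglongrightarrow> W0 $ e \<bullet> x" for e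
    by (intro tendsto_intros Wr yr)
  then have "W0 $ e \<bullet> x = f e x" for e
    unfolding Wf using fr LIMSEQ_unique by blast
  then have "W0 $ e \<in> lovasz_subdifferential (component F e) x" for e
    using W0(1) by (simp add: mem_lovasz_subdifferential_iff)
  then have "(\<Sum>e\<in>UNIV. f e x *\<^sub>R W0 $ e) \<in> laplacian F x"
    unfolding laplacian_alt by blast
  moreover have "(\<lambda>n. \<Sum>e\<in>UNIV. f e (y (r n)) * (W (r n) $ e \<bullet> h))
      \<longlonglongrightarrow> (\<Sum>e\<in>UNIV. f e x * (W0 $ e \<bullet> h))"
    by (intro tendsto_intros Wr fr)
  then have "l * deg_inner F x h \<le> (\<Sum>e\<in>UNIV. f e x * (W0 $ e \<bullet> h))"
    by (rule LIMSEQ_le_const) (use step in blast)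
  then have "l * deg_inner F x h \<le> (\<Sum>e\<in>UNIV. f e x *\<^sub>R W0 $ e) \<bullet> h"
    by (subst inner_sum_left) simp
  ultimately show ?thesis by (rule that)
qed

lemma minimizer_in_laplacian:
  assumes min: "\<And>y. deg_inner F y 1 = 0 \<Longrightarrow> l * deg_inner F y y \<le> energy F y"
    and x: "energy F x = l * deg_inner F x x" "deg_inner F x 1 = 0" and l: "0 \<le> l"
  shows "(\<chi> v. l * d v * x $ v) \<in> laplacian F x" (is "?p \<in> _")
proof (rule ccontr)
  have p: "?p \<bullet> h = l * deg_inner F x h" for h
    by (simp add: inner_vec_def deg_inner_def sum_distrib_left mult_ac)
  assume "?p \<notin> laplacian F x"
  then obtain a b where ab: "a \<bullet> ?p < b" "\<And>z. z \<in> laplacian F x \<Longrightarrow> b < a \<bullet> z"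
    using separating_hyperplane_closed_point[of "laplacian F x" ?p]
      convex_compact_laplacian compact_imp_closed by blast
  \<comment> \<open>The direction \<open>- a\<close> has to be centred first. This changes neither
    pairing: elements of the Laplacian are orthogonal to \<open>1\<close>, and \<open>x\<close> is
    so for \<open>deg_inner\<close>.\<close>
  obtain z where z: "z \<in> laplacian F x" "l * deg_inner F x (center (- a)) \<le> z \<bullet> center (- a)"
    using laplacian_dominates_direction[OF min x deg_inner_center l] .
  have "z \<bullet> center (- a) = - (a \<bullet> z)"
    using laplacian_inner_one[OF z(1)] by (simp add: center_def inner_simps inner_commute)
  moreover have "deg_inner F x (center (- a)) = deg_inner F x (- a)"
    using x(2) by (simp add: center_def deg_inner_simps)
  then have "l * deg_inner F x (center (- a)) = - (a \<bullet> ?p)"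
    using p[of "- a"] by (simp add: inner_commute)
  ultimately show False using z ab by fastforce
qed

text \<open>Substitute x = D^(-1/2) v and multiply the eigenvalue relation by D^(1/2): the
  normalization turns into the factor D in l D x.\<close>

lemma nontrivial_eigenvalue_iff:
  "nontrivial_eigenvalue F l \<longleftrightarrow>
     (\<exists>x. x \<noteq> 0 \<and> (\<chi> v. l * d v * x $ v) \<in> laplacian F x \<and> deg_inner F x 1 = 0)"
proof -
  let ?N = "\<lambda>x. deg_matrix_powr F (- 1 / 2) *v x" and ?P = "\<lambda>x. deg_matrix_powr F (1 / 2) *v x"
  have inv: "d v powr (- 1 / 2) * d v powr (1 / 2) = 1" for v
    using deg_pos[of v] by (simp flip: powr_add)
  have sq: "d v powr (1 / 2) * d v powr (1 / 2) = d v" for v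
    using deg_pos[of v] by (simp flip: powr_add)
  have NP: "?N (?P x) = x" and PN: "?P (?N x) = x" for x
    using inv by (simp_all add: deg_matrix_powr_mult vec_eq_iff mult.assoc[symmetric])
      (simp add: mult.commute)
  have PP: "?P (?P (c *\<^sub>R x)) = (\<chi> v. c * d v * x $ v)" for c x
    using sq by (simp add: deg_matrix_powr_mult vec_eq_iff mult.assoc[symmetric])
  have orth: "orthogonal v (?P 1) \<longleftrightarrow> deg_inner F (?N v) 1 = 0" for v
  proof -
    have "v $ i * d i powr (1 / 2) = d i * (d i powr (- 1 / 2) * v $ i)" for i
      using arg_cong[OF inv[of i], of "\<lambda>a. a * (d i powr (1 / 2) * v $ i)"] sq[of i]
      by (metis (no_types, opaque_lifting) mult.assoc mult.commute mult_1)
    then have "v \<bullet> ?P 1 = deg_inner F (?N v) 1"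
      unfolding inner_vec_def deg_inner_def deg_matrix_powr_mult by (intro sum.cong) simp_all
    then show ?thesis by (simp add: orthogonal_def)
  qed
  have eig: "l *\<^sub>R v \<in> normalized_laplacian F v \<longleftrightarrow> (\<chi> i. l * d i * ?N v $ i) \<in> laplacian F (?N v)" for v
  proof -
    have "?P (?P (l *\<^sub>R ?N v)) = ?P (l *\<^sub>R v)"
      by (simp only: matrix_vector_mult_scaleR PN)
    then have *: "(\<chi> i. l * d i * ?N v $ i) = ?P (l *\<^sub>R v)" by (simp add: PP)
    show ?thesis
      unfolding * normalized_laplacian_def mem_Collect_eq by (metis NP PN)
  qed
  have N0: "?N v = 0 \<longleftrightarrow> v = 0" for v by (metis PN matrix_vector_mult_0_right)
  show ?thesis
  proof
    assume "nontrivial_eigenvalue F l"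
    then obtain v where "v \<noteq> 0" "l *\<^sub>R v \<in> normalized_laplacian F v" "orthogonal v (?P 1)"
      unfolding nontrivial_eigenvalue_def by blast
    then show "\<exists>x. x \<noteq> 0 \<and> (\<chi> v. l * d v * x $ v) \<in> laplacian F x \<and> deg_inner F x 1 = 0"
      unfolding orth eig using N0[of v] by blast
  next
    assume "\<exists>x. x \<noteq> 0 \<and> (\<chi> v. l * d v * x $ v) \<in> laplacian F x \<and> deg_inner F x 1 = 0"
    then obtain x where "x \<noteq> 0" "(\<chi> v. l * d v * x $ v) \<in> laplacian F x" "deg_inner F x 1 = 0"
      by blast
    then have "?P x \<noteq> 0 \<and> l *\<^sub>R ?P x \<in> normalized_laplacian F (?P x) \<and> orthogonal (?P x) (?P 1)"
      unfolding orth eig NP using N0[of "?P x"] NP[of x] by auto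
    then show "nontrivial_eigenvalue F l" unfolding nontrivial_eigenvalue_def by blast
  qed
qed

text \<open>Pair the eigenvalue relation with \<open>x\<close>; each chosen base contributes
  \<open>f e x\<close> once more.\<close>

lemma eigenvalue_rayleigh:
  assumes "(\<chi> v. l * d v * x $ v) \<in> laplacian F x"
  shows "energy F x = l * deg_inner F x x"
proof -
  obtain W where W: "\<And>e. W $ e \<in> lovasz_subdifferential (component F e) x"
    "(\<chi> v. l * d v * x $ v) = (\<Sum>e\<in>UNIV. f e x *\<^sub>R W $ e)"
    using assms by (auto simp: laplacian_alt)
  have "l * deg_inner F x x = (\<chi> v. l * d v * x $ v) \<bullet> x"
    by (simp add: inner_vec_def deg_inner_def sum_distrib_left mult_ac)
  also have "\<dots> = energy F x"
    unfolding W(2) energy_def inner_sum_left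
    by (simp add: lovasz_subdifferential_attains[OF W(1)] power2_eq_square)
  finally show ?thesis ..
qed

text \<open>This justifies the \<open>LEAST\<close> in \<open>lambda_F\<close>: the minimal quotient
  is an eigenvalue, and any other one is the quotient of its own eigenvector.\<close>

lemma lambda_F_minimizes:
  obtains x where "deg_inner F x x = 1" "deg_inner F x 1 = 0" "energy F x = lambda_F F"
    "\<And>y. deg_inner F y 1 = 0 \<Longrightarrow> lambda_F F * deg_inner F y y \<le> energy F y"
proof -
  obtain x where x: "deg_inner F x x = 1" "deg_inner F x 1 = 0"
    "\<And>y. deg_inner F y 1 = 0 \<Longrightarrow> energy F x * deg_inner F y y \<le> energy F y"
    using rayleigh_minimizer by blast
  have "(\<chi> v. energy F x * d v * x $ v) \<in> laplacian F x"
    using x energy_nonneg by (intro minimizer_in_laplacian) auto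
  moreover have "x \<noteq> 0" using x(1) by (auto simp: deg_inner_def)
  ultimately have "nontrivial_eigenvalue F (energy F x)"
    unfolding nontrivial_eigenvalue_iff using x(2) by blast
  moreover have "energy F x \<le> l" if eig: "nontrivial_eigenvalue F l" for l
  proof -
    obtain y where y: "y \<noteq> 0" "(\<chi> v. l * d v * y $ v) \<in> laplacian F y" "deg_inner F y 1 = 0"
      using eig unfolding nontrivial_eigenvalue_iff by blast
    show ?thesis
      using x(3)[OF y(3)] eigenvalue_rayleigh[OF y(2)] deg_inner_pos[OF y(1)] by simp
  qed
  ultimately have "lambda_F F = energy F x"
    unfolding lambda_F_def by (rule Least_equality)
  then show ?thesis using x that by simp
qed

section \<open>The easy direction\<close>

lemma vol_pos: "S \<noteq> {} \<Longrightarrow> 0 < vol F S"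
  unfolding vol_def using deg_pos by (intro sum_pos) auto

lemma vol_compl: "vol F S + vol F (UNIV - S) = vol F UNIV"
  unfolding vol_def by (subst sum.subset_diff[of S UNIV]) auto

lemma cut_nonneg: "0 \<le> cut F S"
  unfolding cut_def by (intro sum_nonneg component_bounds)

text \<open>The value of f_e at the indicator is the mass of a base on \<open>S\<close>, hence at
  most F_e(S); squaring does not increase it because F_e(S) \<le> 1.\<close>

lemma energy_indicator_le_cut: "energy F (\<chi> v. if v \<in> S then 1 else 0) \<le> cut F S" (is "energy F ?x \<le> _")
  unfolding energy_def cut_def
proof (rule sum_mono)
  fix e
  obtain w where "w \<in> lovasz_subdifferential (component F e) ?x"
    using lovasz_subdifferential_nonempty[OF base_nonempty] .
  then have w: "w \<in> B e" "f e ?x = w \<bullet> ?x" by (auto simp: mem_lovasz_subdifferential_iff)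
  have "f e ?x = (\<Sum>v\<in>S. w $ v)"
    unfolding w(2) by (simp add: inner_vec_def if_distrib sum.If_cases cong: if_cong)
  also have "\<dots> \<le> component F e S" using w(1) by (simp add: base_polytope_def)
  finally have le: "f e ?x \<le> component F e S" .
  have "(f e ?x)\<^sup>2 \<le> f e ?x * 1"
    unfolding power2_eq_square using le component_bounds[of e S] f_nonneg
    by (intro mult_left_mono) auto
  then show "(f e ?x)\<^sup>2 \<le> component F e S" using le by simp
qed

lemma lambda_F_nonneg: "0 \<le> lambda_F F"
  by (rule lambda_F_minimizes) (metis energy_nonneg)

text \<open>The centred indicator has squared \<open>deg_inner\<close> norm a b / (a + b), at least
  half of min a b. This is the source of the factor 2.\<close>

lemma lambda_F_le_cut:
  assumes "S \<noteq> {}" "S \<noteq> UNIV"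
  shows "lambda_F F / 2 * min (vol F S) (vol F (UNIV - S)) \<le> cut F S"
proof -
  define a b where "a = vol F S" and "b = vol F (UNIV - S)"
  have ab: "0 < a" "0 < b" using assms by (auto simp: a_def b_def intro!: vol_pos)
  define x :: "real ^ 'v" where "x = (\<chi> v. if v \<in> S then 1 else 0)"
  have x: "deg_inner F x x = a" "deg_inner F x 1 = a"
    by (simp_all add: deg_inner_def x_def a_def vol_def if_distrib if_distribR sum.If_cases cong: if_cong)
  have one: "deg_inner F 1 1 = a + b"
    unfolding a_def b_def vol_compl by (simp add: deg_inner_def vol_def)
  have "deg_inner F (center x) (center x) = a * b / (a + b)"
    unfolding deg_inner_center_center x one using ab by (simp add: field_simps power2_eq_square)
  moreover have "lambda_F F * deg_inner F (center x) (center x) \<le> energy F (center x)"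
    using lambda_F_minimizes deg_inner_center by metis
  ultimately have "lambda_F F * (a * b / (a + b)) \<le> cut F S"
    using energy_indicator_le_cut[of S] by (simp add: energy_center x_def)
  moreover have "min a b / 2 \<le> a * b / (a + b)"
  proof -
    have "min a b * (a + b) \<le> min a b * (2 * max a b)"
      using ab by (intro mult_left_mono) auto
    also have "\<dots> = 2 * (a * b)" by (simp add: min_def max_def)
    finally show ?thesis using ab by (simp add: field_simps)
  qed
  then have "lambda_F F * (min a b / 2) \<le> lambda_F F * (a * b / (a + b))"
    by (intro mult_left_mono lambda_F_nonneg)
  ultimately have "lambda_F F * (min a b / 2) \<le> cut F S" by linarith
  then show ?thesis by (simp add: a_def b_def)
qed

lemma proper_subset_exists: "{S :: 'v set. S \<noteq> {} \<and> S \<subset> UNIV} \<noteq> {}"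
proof -
  obtain p q :: 'v where "p \<noteq> q" using two_vertices .
  then have "{p} \<noteq> {} \<and> {p} \<subset> UNIV" by auto
  then show ?thesis by blast
qed

lemma lambda_F_le_conductance: "lambda_F F / 2 \<le> conductance F"
proof -
  have "lambda_F F / 2 \<le> set_conductance F S" if S: "S \<noteq> {}" "S \<subset> UNIV" for S
  proof -
    have "lambda_F F / 2 * min (vol F S) (vol F (UNIV - S)) \<le> cut F S"
      using S by (intro lambda_F_le_cut) auto
    moreover have "lambda_F F / 2 * min (vol F S) (vol F (UNIV - S)) \<le> cut F (UNIV - S)"
      using lambda_F_le_cut[of "UNIV - S"] S by (auto simp: min.commute double_diff)
    moreover have "0 < min (vol F S) (vol F (UNIV - S))"
      using S by (auto intro!: vol_pos)
    ultimately show ?thesis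
      unfolding set_conductance_def by (subst pos_le_divide_eq) auto
  qed
  then show ?thesis
    unfolding conductance_def using proper_subset_exists by (subst Min_ge_iff) auto
qed

section \<open>The hard direction\<close>

text \<open>Cuts need not be symmetric, so both are recorded: superlevel sets of y use the first,
  sublevel sets the second.\<close>

lemma conductance_vol_le_cut:
  assumes "S \<noteq> {}" "vol F S \<le> vol F UNIV / 2"
  shows "conductance F * vol F S \<le> cut F S" "conductance F * vol F S \<le> cut F (UNIV - S)"
proof -
  have "0 < vol F S" using vol_pos[OF assms(1)] .
  then have "S \<noteq> UNIV" using assms(2) by auto
  then have "conductance F \<le> set_conductance F S"
    unfolding conductance_def using assms(1) by (intro Min_le) auto
  moreover have "min (vol F S) (vol F (UNIV - S)) = vol F S"
    using assms(2) vol_compl[of S] by simp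
  ultimately have "conductance F * vol F S \<le> min (cut F S) (cut F (UNIV - S))"
    using \<open>0 < vol F S\<close> by (simp add: set_conductance_def pos_le_divide_eq)
  then show "conductance F * vol F S \<le> cut F S" "conductance F * vol F S \<le> cut F (UNIV - S)"
    by auto
qed

lemma base_eq_0_outside_supp:
  assumes "w \<in> B e" "v \<notin> supp (component F e)"
  shows "w $ v = 0"
proof -
  have nr: "S \<subseteq> UNIV - {v} \<Longrightarrow> component F e S = component F e (S \<union> {v})" for S
    using assms(2) by (auto simp: supp_def relevant_def)
  have "component F e {v} = 0" using nr[of "{}"] by simp
  moreover have "component F e (UNIV - {v}) = 0"
    using nr[of "UNIV - {v}"] by (simp add: insert_absorb)
  ultimately show ?thesis
    using base_polytope_bounds[OF assms(1), of v] by simp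
qed

text \<open>Take the least value with at most half the volume strictly above it. If a smaller value
  exists, the next one down fails the test, which bounds the volume below.\<close>

lemma weighted_median:
  fixes x :: "'v \<Rightarrow> real"
  obtains c where "vol F {v. c < x v} \<le> vol F UNIV / 2" "vol F {v. x v < c} \<le> vol F UNIV / 2"
proof -
  let ?C = "{c \<in> range x. vol F {v. c < x v} \<le> vol F UNIV / 2}"
  have half: "0 \<le> vol F UNIV / 2" by (simp add: vol_def sum_nonneg)
  have fin: "finite ?C" by simp
  have "Max (range x) \<in> range x" by (rule Max_in) auto
  moreover have "{v. Max (range x) < x v} = {}" by (auto simp: not_less)
  then have "vol F {v. Max (range x) < x v} = 0" unfolding vol_def by (simp only: sum.empty)
  ultimately have "Max (range x) \<in> ?C" using half by (simp only: mem_Collect_eq)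
  then have ne: "?C \<noteq> {}" by blast
  define c where "c = Min ?C"
  have c: "c \<in> ?C" unfolding c_def using fin ne by (rule Min_in)
  have "vol F {v. x v < c} \<le> vol F UNIV / 2"
  proof (cases "{v. x v < c} = {}")
    case True
    then show ?thesis using half by (simp add: vol_def)
  next
    case False
    define c' where "c' = Max (x ` {v. x v < c})"
    have "c' \<in> x ` {v. x v < c}" unfolding c'_def using False by (intro Max_in) auto
    then have c': "c' < c" "c' \<in> range x" by auto
    then have "c' \<notin> ?C" using Min_le[OF fin, of c'] unfolding c_def by linarith
    then have "vol F UNIV / 2 < vol F {v. c' < x v}" using c'(2) by auto
    moreover have "{v. c' < x v} = UNIV - {v. x v < c}"
    proof -
      have "x v \<le> c'" if "x v < c" for v unfolding c'_def using that by (intro Max_ge) auto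
      then show ?thesis using c'(1) by force
    qed
    ultimately show ?thesis using vol_compl[of "{v. x v < c}"] by simp
  qed
  then show ?thesis using c that by blast
qed

text \<open>The derivative of s |s| is 2 |s|, at most 2 M on [-M, M].\<close>

lemma signed_square_lipschitz:
  fixes a b M :: real
  assumes "- M \<le> a" "a \<le> b" "b \<le> M"
  shows "b * \<bar>b\<bar> - a * \<bar>a\<bar> \<le> 2 * M * (b - a)"
proof -
  consider "0 \<le> a" | "b \<le> 0" | "a < 0" "0 < b" by linarith
  then show ?thesis
  proof cases
    case 1
    have "(b - a) * (a + b) \<le> (b - a) * (2 * M)" using assms by (intro mult_left_mono) auto
    then show ?thesis using 1 assms by (simp add: algebra_simps)
  next
    case 2
    have "(b - a) * (- a - b) \<le> (b - a) * (2 * M)" using assms by (intro mult_left_mono) auto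
    then show ?thesis using 2 assms by (simp add: algebra_simps)
  next
    case 3
    then have "b * \<bar>b\<bar> - a * \<bar>a\<bar> = b * b + (- a) * (- a)" by simp
    also have "\<dots> \<le> b * (2 * M) + (- a) * (2 * M)"
      using 3 assms by (intro add_mono mult_left_mono) auto
    finally show ?thesis by (simp add: algebra_simps)
  qed
qed

text \<open>The clamped function \<open>2My - y|y|\<close> is monotone in \<open>y\<close>, so it pairs nonnegatively with a
  base that is tight on the superlevel sets of \<open>y\<close>; clamping is harmless since the base vanishes
  outside the support.\<close>

lemma tight_base_signed_square:
  assumes w: "w \<in> B e" "\<And>U. upper_for (($) y) U \<Longrightarrow> (\<Sum>v\<in>U. w $ v) = component F e U"
    and M: "\<And>v. v \<in> supp (component F e) \<Longrightarrow> \<bar>y $ v\<bar> \<le> M" "0 \<le> M"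
  shows "(\<Sum>v\<in>UNIV. w $ v * (y $ v * \<bar>y $ v\<bar>)) \<le> 2 * M * (w \<bullet> y)"
proof -
  define cl where "cl s = max (- M) (min M s)" for s
  define z where "z v = 2 * M * cl (y $ v) - cl (y $ v) * \<bar>cl (y $ v)\<bar>" for v
  have mono: "z u \<le> z v" if "y $ u \<le> y $ v" for u v
  proof -
    have "- M \<le> cl (y $ u)" "cl (y $ u) \<le> cl (y $ v)" "cl (y $ v) \<le> M"
      using that M(2) by (auto simp: cl_def)
    from signed_square_lipschitz[OF this] show ?thesis by (simp add: z_def algebra_simps)
  qed
  have "0 \<le> (\<Sum>v\<in>UNIV. w $ v * z v)"
  proof (rule sum_mult_nonneg_of_superlevel)
    show "(\<Sum>v\<in>UNIV. w $ v) = 0" by (rule base_sum[OF w(1)])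
    fix t
    \<comment> \<open>Superlevel sets of \<open>z\<close> are upper for \<open>y\<close>, so on them
      \<open>w\<close> sums to a nonnegative value of F_e.\<close>
    have "upper_for (($) y) {v. t \<le> z v}"
      unfolding upper_for_def using mono by (auto intro: order_trans)
    then show "0 \<le> (\<Sum>v\<in>{v. t \<le> z v}. w $ v)" by (simp add: w(2) component_bounds)
  qed
  also have "\<dots> = (\<Sum>v\<in>UNIV. w $ v * (2 * M * y $ v - y $ v * \<bar>y $ v\<bar>))"
  proof (rule sum.cong)
    fix v
    show "w $ v * z v = w $ v * (2 * M * y $ v - y $ v * \<bar>y $ v\<bar>)"
    proof (cases "v \<in> supp (component F e)")
      case True
      then have "cl (y $ v) = y $ v" using M(1)[OF True] by (auto simp: cl_def abs_le_iff)
      then show ?thesis by (simp add: z_def)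
    next
      case False
      then show ?thesis using base_eq_0_outside_supp[OF w(1) False] by simp
    qed
  qed simp
  also have "\<dots> = 2 * M * (w \<bullet> y) - (\<Sum>v\<in>UNIV. w $ v * (y $ v * \<bar>y $ v\<bar>))"
    by (simp add: inner_vec_def sum_distrib_left sum_subtractf algebra_simps)
  finally show ?thesis by simp
qed

text \<open>Double counting of the pairs (e, v) with v in the support of F_e.\<close>

lemma deg_inner_as_edge_sum:
  "deg_inner F y y = (\<Sum>e\<in>UNIV. \<Sum>v\<in>supp (component F e). (y $ v)\<^sup>2)"
proof -
  have "(\<Sum>e\<in>UNIV. \<Sum>v\<in>supp (component F e). (y $ v)\<^sup>2)
      = (\<Sum>e\<in>UNIV. \<Sum>v\<in>UNIV. if v \<in> supp (component F e) then (y $ v)\<^sup>2 else 0)"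
    by (simp add: sum.If_cases)
  also have "\<dots> = (\<Sum>v\<in>UNIV. \<Sum>e\<in>UNIV. if v \<in> supp (component F e) then (y $ v)\<^sup>2 else 0)"
    by (rule sum.swap)
  also have "\<dots> = (\<Sum>v\<in>UNIV. d v * (y $ v)\<^sup>2)"
    by (simp add: sum.If_cases deg_def)
  finally show ?thesis by (simp add: deg_inner_def power2_eq_square mult.assoc)
qed

text \<open>Let p and n be the squares of the positive and negative parts of y, so that y |y| = p -
  n and y^2 = p + n. The layer-cake inequality is applied to each; the median condition keeps their
  level sets at no more than half the volume.\<close>

lemma conductance_deg_inner_le:
  assumes med: "vol F {v. 0 < y $ v} \<le> vol F UNIV / 2" "vol F {v. y $ v < 0} \<le> vol F UNIV / 2"
    and w: "\<And>e. w e \<in> B e"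
      "\<And>e U. upper_for (($) y) U \<Longrightarrow> (\<Sum>v\<in>U. w e $ v) = component F e U"
  shows "conductance F * deg_inner F y y \<le> (\<Sum>e\<in>UNIV. \<Sum>v\<in>UNIV. w e $ v * (y $ v * \<bar>y $ v\<bar>))"
proof -
  define W where "W v = (\<Sum>e\<in>UNIV. w e $ v)" for v
  have W_upper: "sum W U = cut F U" if "upper_for (($) y) U" for U
    unfolding W_def cut_def by (subst sum.swap) (simp add: w(2)[OF that])
  have W_total: "sum W UNIV = 0"
    unfolding W_def by (subst sum.swap) (simp add: base_sum[OF w(1)])
  define p n where "p v = (max 0 (y $ v))\<^sup>2" and "n v = (max 0 (- y $ v))\<^sup>2" for v
  have vol_mono: "vol F S \<le> vol F T" if "S \<subseteq> T" for S T
    unfolding vol_def using that by (intro sum_mono2) auto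
  \<comment> \<open>The sign \<open>a\<close> is 1 for p and - 1 for n, which explains the explicit
    factors below.\<close>
  have sum_W: "(\<Sum>v\<in>S. a * W v - conductance F * d v) = a * sum W S - conductance F * vol F S" for S a
    by (simp add: sum_subtractf sum_distrib_left vol_def)
  have "0 \<le> (\<Sum>v\<in>UNIV. (1 * W v - conductance F * d v) * p v)"
  proof (rule sum_mult_nonneg_of_superlevel_nonneg)
    fix t :: real assume t: "0 < t"
    let ?U = "{v \<in> UNIV. t \<le> p v}"
    have up: "upper_for (($) y) ?U"
      unfolding upper_for_def p_def by (auto elim!: order_trans intro!: power_mono)
    have "?U \<subseteq> {v. 0 < y $ v}" using t by (force simp: p_def max_def order_le_less split: if_splits)
    then have "vol F ?U \<le> vol F UNIV / 2" using vol_mono med(1) order_trans by blast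
    then have "conductance F * vol F ?U \<le> cut F ?U"
      using conductance_vol_le_cut(1)[of ?U] cut_nonneg by (cases "?U = {}") (auto simp: vol_def)
    then show "0 \<le> (\<Sum>v\<in>?U. 1 * W v - conductance F * d v)"
      unfolding sum_W W_upper[OF up] by simp
  qed (auto simp: p_def)
  moreover have "0 \<le> (\<Sum>v\<in>UNIV. (- 1 * W v - conductance F * d v) * n v)"
  proof (rule sum_mult_nonneg_of_superlevel_nonneg)
    fix t :: real assume t: "0 < t"
    let ?U = "{v \<in> UNIV. t \<le> n v}"
    have n_mono: "n u \<le> n v" if "y $ v \<le> y $ u" for u v
      unfolding n_def using that by (intro power_mono) auto
    have up: "upper_for (($) y) (UNIV - ?U)"
      unfolding upper_for_def using n_mono by (fastforce simp: not_le intro: le_less_trans)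
    \<comment> \<open>Level sets of \<open>n\<close> are sublevel sets of y; tightness on the
      complement and total mass zero determine their mass.\<close>
    have "sum W ?U = - cut F (UNIV - ?U)"
      using W_total W_upper[OF up] sum.subset_diff[of ?U UNIV W] by simp
    moreover have "?U \<subseteq> {v. y $ v < 0}" using t by (force simp: n_def max_def order_le_less split: if_splits)
    then have "vol F ?U \<le> vol F UNIV / 2" using vol_mono med(2) order_trans by blast
    then have "conductance F * vol F ?U \<le> cut F (UNIV - ?U)"
      using conductance_vol_le_cut(2)[of ?U] cut_nonneg by (cases "?U = {}") (auto simp: vol_def)
    ultimately show "0 \<le> (\<Sum>v\<in>?U. - 1 * W v - conductance F * d v)"
      unfolding sum_W by simp
  qed (auto simp: n_def)
  ultimately have "0 \<le> (\<Sum>v\<in>UNIV. (1 * W v - conductance F * d v) * p v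
      + (- 1 * W v - conductance F * d v) * n v)"
    by (simp add: sum.distrib)
  also have "\<dots> = (\<Sum>v\<in>UNIV. W v * (y $ v * \<bar>y $ v\<bar>) - conductance F * (d v * y $ v * y $ v))"
    by (rule sum.cong) (auto simp: p_def n_def max_def power2_eq_square abs_if algebra_simps)
  also have "\<dots> = (\<Sum>v\<in>UNIV. W v * (y $ v * \<bar>y $ v\<bar>)) - conductance F * deg_inner F y y"
    by (simp add: sum_subtractf sum_distrib_left deg_inner_def)
  also have "(\<Sum>v\<in>UNIV. W v * (y $ v * \<bar>y $ v\<bar>)) = (\<Sum>e\<in>UNIV. \<Sum>v\<in>UNIV. w e $ v * (y $ v * \<bar>y $ v\<bar>))"
    unfolding W_def sum_distrib_right by (rule sum.swap)
  finally show ?thesis by simp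
qed

lemma conductance_le_sqrt_energy:
  assumes "vol F {v. 0 < y $ v} \<le> vol F UNIV / 2" "vol F {v. y $ v < 0} \<le> vol F UNIV / 2"
  shows "conductance F * deg_inner F y y \<le> 2 * sqrt (energy F y) * sqrt (deg_inner F y y)"
proof -
  have "\<exists>w. w \<in> B e \<and> (\<forall>U. upper_for (($) y) U \<longrightarrow> (\<Sum>v\<in>U. w $ v) = component F e U)" for e
    using greedy_base[OF submodular_component, of e "($) y"] component_simps(1) by metis
  then obtain w where w: "\<And>e. w e \<in> B e"
    "\<And>e U. upper_for (($) y) U \<Longrightarrow> (\<Sum>v\<in>U. w e $ v) = component F e U" by metis
  \<comment> \<open>The l2 norm over the support bounds |y| there, and its squares sum over e to
    exactly \<open>deg_inner F y y\<close>, the factor wanted from Cauchy-Schwarz.\<close>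
  define M where "M e = sqrt (\<Sum>v\<in>supp (component F e). (y $ v)\<^sup>2)" for e
  have M_nonneg: "0 \<le> M e" for e by (simp add: M_def sum_nonneg)
  have M: "\<bar>y $ v\<bar> \<le> M e" if "v \<in> supp (component F e)" for e v
  proof -
    have "(y $ v)\<^sup>2 \<le> (\<Sum>v\<in>supp (component F e). (y $ v)\<^sup>2)"
      using that by (intro member_le_sum) auto
    then show ?thesis unfolding M_def by (intro real_le_rsqrt) simp
  qed
  have "conductance F * deg_inner F y y \<le> (\<Sum>e\<in>UNIV. \<Sum>v\<in>UNIV. w e $ v * (y $ v * \<bar>y $ v\<bar>))"
    using assms w by (rule conductance_deg_inner_le)
  also have "\<dots> \<le> (\<Sum>e\<in>UNIV. 2 * M e * f e y)"
  proof (rule sum_mono)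
    fix e
    have "(\<Sum>v\<in>UNIV. w e $ v * (y $ v * \<bar>y $ v\<bar>)) \<le> 2 * M e * (w e \<bullet> y)"
      using w M M_nonneg by (intro tight_base_signed_square) auto
    also have "\<dots> \<le> 2 * M e * f e y"
      using M_nonneg inner_le_lovasz_extension[OF w(1)] by (intro mult_left_mono) auto
    finally show "(\<Sum>v\<in>UNIV. w e $ v * (y $ v * \<bar>y $ v\<bar>)) \<le> 2 * M e * f e y" .
  qed
  also have "\<dots> = 2 * (\<Sum>e\<in>UNIV. f e y * M e)"
    by (simp add: sum_distrib_left mult_ac)
  also have "(\<Sum>e\<in>UNIV. f e y * M e) \<le> L2_set (\<lambda>e. f e y) UNIV * L2_set M UNIV"
    using L2_set_mult_ineq[of "\<lambda>e. f e y" M UNIV] f_nonneg M_nonneg by simp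
  also have "L2_set (\<lambda>e. f e y) UNIV = sqrt (energy F y)"
    by (simp add: L2_set_def energy_def)
  also have "L2_set M UNIV = sqrt (deg_inner F y y)"
    by (simp add: L2_set_def M_def deg_inner_as_edge_sum sum_nonneg)
  finally show ?thesis by simp
qed

text \<open>The median shift preserves the energy, and since x is orthogonal to \<open>1\<close> it
  can only increase the norm. So N = \<open>deg_inner F y y\<close> is at least 1, sqrt N \<le> N,
  and N cancels.\<close>

lemma conductance_le_sqrt_lambda_F: "conductance F \<le> 2 * sqrt (lambda_F F)"
proof -
  obtain x where x: "deg_inner F x x = 1" "deg_inner F x 1 = 0" "energy F x = lambda_F F"
    using lambda_F_minimizes by metis
  obtain c where c: "vol F {v. c < x $ v} \<le> vol F UNIV / 2" "vol F {v. x $ v < c} \<le> vol F UNIV / 2"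
    using weighted_median[of "($) x"] by metis
  define y where "y = x + (- c) *\<^sub>R 1"
  have N: "1 \<le> deg_inner F y y"
    unfolding y_def using x(1,2) deg_inner_commute[of F 1 x] deg_inner_nonneg[of F 1]
    by (simp add: deg_inner_simps mult.assoc[symmetric])
  have "conductance F * deg_inner F y y \<le> 2 * sqrt (energy F y) * sqrt (deg_inner F y y)"
    using c by (intro conductance_le_sqrt_energy) (simp_all add: y_def)
  also have "energy F y = lambda_F F" unfolding y_def energy_add_const x(3) ..
  also have "2 * sqrt (lambda_F F) * sqrt (deg_inner F y y)
      \<le> 2 * sqrt (lambda_F F) * deg_inner F y y"
    using N lambda_F_nonneg by (intro mult_left_mono real_le_lsqrt) (auto simp: power2_eq_square)
  finally show ?thesis using N by simp
qed

end

theorem theorem1p1: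
  fixes F :: "'v::finite set \<Rightarrow> real ^ 'e::finite"
  assumes "submodular_transformation F"
    and "F {} = 0" and "F UNIV = 0"
    and "\<And>S e. F S $ e \<in> {0..1}"
    and "\<And>v. 0 < deg F v"
  shows "lambda_F F / 2 \<le> conductance F \<and> conductance F \<le> 2 * sqrt (lambda_F F)"
proof -
  interpret bounded_submodular_transformation F
    using assms by unfold_locales
  show ?thesis using lambda_F_le_conductance conductance_le_sqrt_lambda_F by blast
qed

end
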